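(* Let $\alpha$ and $\beta$ be complex numbers such that $\alpha \neq \beta$ and such that $\alpha$ and $\beta$ are not both integers. Then it is not the case that $\alpha^n - \beta^n \in \mathbb{Z}$ for every positive integer $n$. *)

theory Defs
  imports Complex_Main
begin

end

theory Submission
  imports Defs "HOL-Number_Theory.Cong"
begin

text \<open>
  Division by \<open>\<alpha> - \<beta>\<close> shows that \<open>\<alpha> + \<beta>\<close> is rational, hence \<open>\<alpha> = a/q\<close> and \<open>\<beta> = b/q\<close> with
  \<open>a\<close> coprime to \<open>q\<close> and \<open>a \<equiv> b\<close> modulo \<open>q\<close>, and \<open>q\<^sup>n\<close> divides \<open>a\<^sup>n - b\<^sup>n\<close> for all \<open>n\<close>.
  For \<open>n \<equiv> 1\<close> modulo \<open>q\<close> the cofactor of \<open>a - b\<close> in \<open>a\<^sup>n - b\<^sup>n\<close> is congruent to \<open>a\<^bsup>n-1\<^esup>\<close>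
  modulo \<open>q\<close>, so \<open>q\<^sup>n\<close> divides \<open>a - b\<close>, which is impossible for large \<open>n\<close> unless \<open>q = 1\<close>.
\<close>

text \<open>Modulo \<open>q\<close> each of the \<open>n\<close> summands becomes
  \<open>a ^ (n - 1)\<close>, and the resulting factor \<open>n\<close> becomes 1.\<close>

lemma coprime_power_diff_cofactor:
  fixes a b q :: int
  assumes "coprime a q" "[b = a] (mod q)" "[int n = 1] (mod q)"
  shows "coprime (\<Sum>i<n. b ^ (n - Suc i) * a ^ i) q"
proof -
  have "[(\<Sum>i<n. b ^ (n - Suc i) * a ^ i) = (\<Sum>i<n. a ^ (n - Suc i) * a ^ i)] (mod q)"
    by (intro cong_sum cong_mult cong_pow cong_refl assms)
  also have "(\<Sum>i<n. a ^ (n - Suc i) * a ^ i) = int n * a ^ (n - 1)"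
    by (simp flip: power_add)
  also have "[int n * a ^ (n - 1) = 1 * a ^ (n - 1)] (mod q)"
    by (intro cong_mult cong_refl assms)
  finally show ?thesis
    by (rule cong_imp_coprime[OF cong_sym]) (use assms(1) in simp)
qed

lemma coprime_denom_eq_1_if_power_dvd_power_diff:
  fixes a b q :: int
  assumes "q > 0" "coprime a q" "a \<noteq> b"
    and dvd: "\<And>n. n > 0 \<Longrightarrow> q ^ n dvd a ^ n - b ^ n"
  shows "q = 1"
proof (rule ccontr)
  assume "q \<noteq> 1"
  define m where "m = nat \<bar>a - b\<bar>"
  \<comment> \<open>This exponent is 1 modulo \<open>q\<close>, so the cofactor is coprime to
    \<open>q\<close>; it also exceeds \<open>m\<close>, so \<open>q ^ n \<ge> 2 ^ n > n > m\<close>,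
    too large for a divisor of the nonzero \<open>a - b\<close>.\<close>
  define n where "n = nat q * m + 1"
  have "[b = a] (mod q)"
    using dvd[of 1] by (simp add: cong_iff_dvd_diff dvd_diff_commute)
  moreover have "[int n = 1] (mod q)"
    using \<open>q > 0\<close> by (simp add: n_def cong_iff_dvd_diff)
  ultimately have "coprime (q ^ n) (\<Sum>i<n. b ^ (n - Suc i) * a ^ i)"
    using coprime_power_diff_cofactor[OF assms(2)] by (simp add: coprime_commute)
  moreover have "q ^ n dvd (a - b) * (\<Sum>i<n. b ^ (n - Suc i) * a ^ i)"
    using dvd[of n] unfolding power_diff_sumr2[symmetric] by (simp add: n_def)
  ultimately have "q ^ n dvd a - b"
    by (simp add: coprime_dvd_mult_left_iff)
  then have "q ^ n \<le> int m"
    using \<open>a \<noteq> b\<close> by (auto simp: m_def intro!: zdvd_imp_le)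
  also have "m \<le> nat q * m"
    using \<open>q > 0\<close> by (simp add: Suc_le_eq)
  then have "int m < int n"
    unfolding n_def by linarith
  also have "int n < 2 ^ n"
    by (rule of_nat_less_two_power)
  also have "(2::int) ^ n \<le> q ^ n"
    using \<open>q > 0\<close> \<open>q \<noteq> 1\<close> by (intro power_mono) auto
  finally show False by simp
qed

lemma Ints_if_Rats_diff_powers_Ints:
  fixes x y :: "'a :: field_char_0"
  assumes "x \<in> \<rat>" "x \<noteq> y"
    and Ints: "\<And>n. n > 0 \<Longrightarrow> x ^ n - y ^ n \<in> \<int>"
  shows "x \<in> \<int>"
proof -
  obtain a q where q: "q > 0" "coprime a q" and x: "x = of_int a / of_int q"
    using Rats_cases'[OF assms(1)] by metis
  obtain d where d: "x - y = of_int d"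
    using Ints[of 1] by (auto elim: Ints_cases)
  \<comment> \<open>As \<open>x - y\<close> is the integer \<open>d\<close>, \<open>y\<close> can be
    written over the same denominator \<open>q\<close>.\<close>
  define b where "b = a - d * q"
  have "y = x - of_int d"
    using d by (simp add: algebra_simps)
  then have y: "y = of_int b / of_int q"
    using q by (simp add: b_def x field_simps)
  have "q ^ n dvd a ^ n - b ^ n" if n: "n > 0" for n
  proof -
    obtain k where "x ^ n - y ^ n = of_int k"
      using Ints[OF n] by (rule Ints_cases)
    then have "(of_int (a ^ n - b ^ n) :: 'a) = of_int (q ^ n * k)"
      using q by (simp add: x y field_simps)
    then show ?thesis
      unfolding of_int_eq_iff by simp
  qed
  moreover have "a \<noteq> b"
    using \<open>x \<noteq> y\<close> x y by auto
  ultimately have "q = 1"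
    using q by (intro coprime_denom_eq_1_if_power_dvd_power_diff)
  then show ?thesis
    by (simp add: x)
qed

theorem mainTheorem3:
  fixes \<alpha> \<beta> :: complex
  assumes "\<alpha> \<noteq> \<beta>"
    and "\<not> (\<alpha> \<in> \<int> \<and> \<beta> \<in> \<int>)"
  shows "\<not> (\<forall>n::nat. n > 0 \<longrightarrow> \<alpha> ^ n - \<beta> ^ n \<in> \<int>)"
proof
  assume *: "\<forall>n::nat. n > 0 \<longrightarrow> \<alpha> ^ n - \<beta> ^ n \<in> \<int>"
  then have diff: "\<alpha> - \<beta> \<in> \<int>"
    by (metis power_one_right zero_less_one)
  \<comment> \<open>The quotient is \<open>\<alpha> + \<beta>\<close>; averaging it with
    \<open>\<alpha> - \<beta>\<close> isolates \<open>\<alpha>\<close>.\<close>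
  have "\<alpha> = ((\<alpha> ^ 2 - \<beta> ^ 2) / (\<alpha> - \<beta>) + (\<alpha> - \<beta>)) / 2"
    using \<open>\<alpha> \<noteq> \<beta>\<close> by (simp add: field_simps power2_eq_square)
  moreover have "\<alpha> ^ 2 - \<beta> ^ 2 \<in> \<rat>" "\<alpha> - \<beta> \<in> \<rat>"
    using * diff Ints_subset_Rats by auto
  ultimately have "\<alpha> \<in> \<rat>"
    by (metis Rats_add Rats_divide Rats_number_of)
  then have "\<alpha> \<in> \<int>"
    using Ints_if_Rats_diff_powers_Ints \<open>\<alpha> \<noteq> \<beta>\<close> * by blast
  moreover from this have "\<beta> \<in> \<int>"
    using Ints_diff[OF _ diff] by force
  ultimately show False
    using assms(2) by simp
qed

end
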